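(* Let $u$ solve the Neumann problem $u_t=u_{xx}$ in $(0,1)\times(0,\infty)$, $u_x(0,t)=u_x(1,t)=0$ for $t>0$, $u(x,0)=\cos(2\pi x)+1$ on $[0,1]$. For $N>0$ let $v=v^N$ solve $$v_t=v_{xx}+N v_x\Phi_x+N v\,\Phi_{xx}\quad\text{in }\mathbb{R}\times(0,\infty),\qquad v(x,0)=v_0(x),$$ where $\Phi(x)=|x|^3$ for $x\le 0$, $\Phi(x)=0$ for $0<x<1$, $\Phi(x)=|x-1|^3$ for $x\ge1$, and $$v_0(x)=\begin{cases}\cos(2\pi x)+1 & x\in[0,1],\\ 2e^{Nx^3} & x<0,\\ 2e^{-N(x-1)^3} & x>1.\end{cases}$$ Then there exists a time $T$ so that for all $N$, $$\sup_{[0,1]\times[0,T]}|u(x,t)-v(x,t)|\ge C N^{-1/3},$$ where $C>0$ is a constant independent of $N$.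
   Formalization: The bound is proved for all N≥N0 with C depending on the arbitrary cutoff N0>0 (T absolute), since for N→0 the sup stays ≤2 while C N^{-1/3} blows up; v is the solution with x²v(x,t)→0 as |x|→∞, uniformly on bounded time intervals, a condition needed for uniqueness. *)

theory Defs
  imports "HOL-Analysis.Analysis"
begin

text \<open>
  Functions of space and time are curried: \<open>f x t\<close> is the value at position \<open>x\<close> and time \<open>t\<close>.
\<close>

definition Dt :: "(real \<Rightarrow> real \<Rightarrow> real) \<Rightarrow> real \<Rightarrow> real \<Rightarrow> real" where
  "Dt f x t = deriv (\<lambda>s. f x s) t"

definition Dx :: "(real \<Rightarrow> real \<Rightarrow> real) \<Rightarrow> real \<Rightarrow> real \<Rightarrow> real" where
  "Dx f x t = deriv (\<lambda>y. f y t) x"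

text \<open>
  The parabolic class \<open>C\<^sup>2\<^sup>,\<^sup>1\<close>: \<open>f\<^sub>t\<close>, \<open>f\<^sub>x\<close>, \<open>f\<^sub>x\<^sub>x\<close> exist and are continuous on \<open>A\<close>. It is used for open
  \<open>A\<close> only. The differentiability clauses are needed because \<^const>\<open>deriv\<close> is total.
\<close>

definition C21_on :: "(real \<times> real) set \<Rightarrow> (real \<Rightarrow> real \<Rightarrow> real) \<Rightarrow> bool" where
  "C21_on A f \<longleftrightarrow>
     (\<forall>(x, t)\<in>A. (\<lambda>s. f x s) differentiable (at t) \<and>
                 (\<lambda>y. f y t) differentiable (at x) \<and>
                 (\<lambda>y. Dx f y t) differentiable (at x)) \<and>
     continuous_on A (\<lambda>(x, t). Dt f x t) \<and>
     continuous_on A (\<lambda>(x, t). Dx f x t) \<and>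
     continuous_on A (\<lambda>(x, t). Dx (Dx f) x t)"

definition u0 :: "real \<Rightarrow> real" where
  "u0 x = cos (2 * pi * x) + 1"

text \<open>
  Classical solutions of the Neumann problem for the heat equation on \<open>(0,1)\<close>. The boundary
  derivatives are one-sided.
\<close>

definition neumann_solution :: "(real \<Rightarrow> real \<Rightarrow> real) \<Rightarrow> bool" where
  "neumann_solution u \<longleftrightarrow>
     continuous_on ({0..1} \<times> {0..}) (\<lambda>(x, t). u x t) \<and>
     C21_on ({0<..<1} \<times> {0<..}) u \<and>
     (\<forall>x\<in>{0<..<1}. \<forall>t>0. Dt u x t = Dx (Dx u) x t) \<and>
     (\<forall>t>0. ((\<lambda>x. u x t) has_real_derivative 0) (at 0 within {0..1})) \<and>
     (\<forall>t>0. ((\<lambda>x. u x t) has_real_derivative 0) (at 1 within {0..1})) \<and>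
     (\<forall>x\<in>{0..1}. u x 0 = u0 x)"

definition \<Phi> :: "real \<Rightarrow> real" where
  "\<Phi> x = (if x \<le> 0 then \<bar>x\<bar> ^ 3 else if x < 1 then 0 else \<bar>x - 1\<bar> ^ 3)"

definition v0 :: "real \<Rightarrow> real \<Rightarrow> real" where
  "v0 N x = (if x < 0 then 2 * exp (N * x ^ 3)
             else if x \<le> 1 then cos (2 * pi * x) + 1
             else 2 * exp (- N * (x - 1) ^ 3))"

text \<open>
  Classical solutions of the drift problem on the whole line. As always for Cauchy problems on an
  unbounded domain, a condition at infinity is needed to single out the solution: the inward drift
  grows quadratically, so mass can enter from infinity in finite time, and the solutions carrying a
  flux \<open>J\<close> from infinity behave like \<open>J / (N \<Phi>\<^sub>x)\<close>, that is, like \<open>1 / x\<^sup>2\<close>. The last clause,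
  \<open>v x t = o(1 / x\<^sup>2)\<close> uniformly on bounded time intervals, excludes exactly this. It is much weaker
  than decay at the rate \<open>exp (- N \<Phi>)\<close> of the initial datum.
\<close>

definition drift_solution :: "real \<Rightarrow> (real \<Rightarrow> real \<Rightarrow> real) \<Rightarrow> bool" where
  "drift_solution N v \<longleftrightarrow>
     continuous_on (UNIV \<times> {0..}) (\<lambda>(x, t). v x t) \<and>
     C21_on (UNIV \<times> {0<..}) v \<and>
     (\<forall>x. \<forall>t>0. Dt v x t =
        Dx (Dx v) x t + N * Dx v x t * deriv \<Phi> x + N * v x t * deriv (deriv \<Phi>) x) \<and>
     (\<forall>x. v x 0 = v0 N x) \<and>
     (\<forall>S>0. uniform_limit {0..S} (\<lambda>x t. x\<^sup>2 * v x t) (\<lambda>t. 0) at_infinity)"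

end

theory Submission
  imports Defs
begin

text \<open>
  Outside \<open>[0, 1]\<close> the datum of \<open>v\<close> is the Gibbs state \<open>2 exp (- N \<Phi>)\<close>, a stationary solution of the
  drift equation, and inside it lies below that state. So consider the deficit
  \<open>W = 2 exp (- N \<Phi>) - v\<close>. It solves the same equation, starts as \<open>1 - cos (2 \<pi> x)\<close> on \<open>[0, 1]\<close> and as
  \<open>0\<close> outside, stays nonnegative (\<open>drift_equation.nonneg\<close>), and has total mass at most \<open>1\<close>
  (\<open>drift_equation.mass_le\<close>).

  Suppose \<open>\<bar>u - v\<bar> \<le> e\<close> on \<open>[0, 1] \<times> [0, 1]\<close>. The mass of \<open>u\<close> never exceeds its
  initial value \<open>1\<close> (\<open>neumann_solution_mass_le\<close>), so the mass of \<open>W\<close> in \<open>[0, 1]\<close> is at least \<open>1 - e\<close> and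
  at most \<open>e\<close> of it is found outside. This is incompatible with a small \<open>e\<close>, because the ends of \<open>[0, 1]\<close> are leaky:
  mass of \<open>W\<close> that diffuses out spreads over the length \<open>N powr (-1/3)\<close> on which the confinement acts.
  To make this quantitative, test \<open>W\<close> against a \<open>C\<^sup>1\<close> bump \<open>\<theta> \<ge> 0\<close> which is
  \<open>l/2 + x - x\<^sup>2\<close> on \<open>[0, 1]\<close> and falls to zero quadratically over the distance \<open>l\<close> on either side. The
  adjoint operator \<open>\<theta>'' - N \<Phi>' \<theta>'\<close> equals \<open>-2\<close> on \<open>[0, 1]\<close> and is at most \<open>1/l + 3 N l\<^sup>2\<close> outside. Hence
  \<open>\<integral> W \<theta>\<close>, which starts at most at \<open>l/2 + 1/4\<close>, has a derivative of at most
  \<open>- 2 (1 - e) + (1/l + 3 N l\<^sup>2) e\<close>. As it is still nonnegative at time \<open>1\<close>, this forces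
  \<open>(2 + 1/l + 3 N l\<^sup>2) e \<ge> 5/4\<close> for \<open>l \<le> 1\<close> (\<open>drift_equation.interior_defect_lower_bound\<close>).
  The choice of \<open>l\<close> proportional to \<open>N powr (-1/3)\<close> balances the two terms and gives the rate.
\<close>

section \<open>The potential\<close>

lemma DERIV_positive_part_power:
  "((\<lambda>x::real. max 0 x ^ (n + 2)) has_real_derivative real (n + 2) * max 0 x ^ (n + 1)) (at x)"
proof (cases x "0::real" rule: linorder_cases)
  case less
  show ?thesis
    by (rule has_field_derivative_transform_within_open[of "\<lambda>_. 0" _ _ "{..<0}"])
      (use less in \<open>auto simp: max_def\<close>)
next
  case equal
  have "((\<lambda>h::real. max 0 h ^ (n + 2) / h) \<longlongrightarrow> 0) (at 0)"
  proof (rule Lim_null_comparison)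
    show "\<forall>\<^sub>F h in at (0::real). norm (max 0 h ^ (n + 2) / h) \<le> \<bar>h\<bar> ^ (n + 1)"
    proof (rule always_eventually, rule allI)
      fix h :: real
      show "norm (max 0 h ^ (n + 2) / h) \<le> \<bar>h\<bar> ^ (n + 1)"
        using zero_le_power[of "\<bar>h\<bar>" "n + 1"]
        by (cases "h > 0") (simp_all add: max_absorb1 max_absorb2)
    qed
    show "((\<lambda>h::real. \<bar>h\<bar> ^ (n + 1)) \<longlongrightarrow> 0) (at 0)"
      by (auto intro!: tendsto_eq_intros)
  qed
  then show ?thesis
    using equal by (simp add: DERIV_def)
next
  case greater
  show ?thesis
    by (rule has_field_derivative_transform_within_open[of "\<lambda>x. x ^ (n + 2)" _ _ "{0<..}"])
      (use greater DERIV_power[OF DERIV_ident, of "n + 2" x UNIV] in \<open>auto simp: max_def\<close>)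
qed

lemma DERIV_positive_part_cube:
  assumes "(f has_real_derivative D) (at x)"
  shows "((\<lambda>x. max 0 (f x) ^ 3) has_real_derivative 3 * max 0 (f x) ^ 2 * D) (at x)"
  using DERIV_chain2[OF DERIV_positive_part_power[of 1] assms]
  by (simp add: power2_eq_square power3_eq_cube numeral_3_eq_3)

lemma DERIV_positive_part_square:
  assumes "(f has_real_derivative D) (at x)"
  shows "((\<lambda>x. max 0 (f x) ^ 2) has_real_derivative 2 * max 0 (f x) * D) (at x)"
  using DERIV_chain2[OF DERIV_positive_part_power[of 0] assms] by (simp add: numeral_2_eq_2)

lemma Phi_eq: "\<Phi> x = max 0 (- x) ^ 3 + max 0 (x - 1) ^ 3"
  by (auto simp: \<Phi>_def max_def)

text \<open>
  The first two derivatives of \<open>\<Phi>\<close>. Positive parts make the regularity at the two gluing points \<open>0\<close>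
  and \<open>1\<close> automatic.
\<close>

definition drift :: "real \<Rightarrow> real" where
  "drift x = 3 * max 0 (x - 1) ^ 2 - 3 * max 0 (- x) ^ 2"

definition drift' :: "real \<Rightarrow> real" where
  "drift' x = 6 * max 0 (x - 1) + 6 * max 0 (- x)"

lemma DERIV_Phi: "(\<Phi> has_real_derivative drift x) (at x)"
  unfolding Phi_eq[abs_def] drift_def
  by (rule derivative_eq_intros DERIV_positive_part_cube refl | simp)+

lemma DERIV_drift: "(drift has_real_derivative drift' x) (at x)"
  unfolding drift_def[abs_def] drift'_def
  by (rule derivative_eq_intros DERIV_positive_part_square refl | simp)+

lemma deriv_Phi: "deriv \<Phi> = drift" "deriv drift = drift'"
  by (intro ext DERIV_imp_deriv DERIV_Phi DERIV_drift)+

lemma drift_cases: "drift x = (if x \<le> 0 then - 3 * x\<^sup>2 else if x \<le> 1 then 0 else 3 * (x - 1)\<^sup>2)"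
  by (auto simp: drift_def max_def)

lemma drift'_cases: "drift' x = (if x \<le> 0 then - 6 * x else if x \<le> 1 then 0 else 6 * (x - 1))"
  by (auto simp: drift'_def max_def)

lemma abs_drift_le: "\<bar>drift x\<bar> \<le> 3 * x\<^sup>2"
  by (auto simp: drift_cases intro!: power_mono)

lemma drift_inside: "0 \<le> x \<Longrightarrow> x \<le> 1 \<Longrightarrow> drift x = 0"
  by (simp add: drift_def)

lemma continuous_on_drift [continuous_intros]:
  "continuous_on A f \<Longrightarrow> continuous_on A (\<lambda>x. drift (f x))"
  unfolding drift_def by (intro continuous_intros)

section \<open>Elementary calculus on the line\<close>

lemma interior_min_second_derivative:
  fixes f :: "real \<Rightarrow> real"
  assumes x: "a < x" "x < b"
    and min: "\<And>y. a < y \<Longrightarrow> y < b \<Longrightarrow> f x \<le> f y"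
    and f': "\<And>y. a < y \<Longrightarrow> y < b \<Longrightarrow> (f has_real_derivative f' y) (at y)"
    and f'': "(f' has_real_derivative D) (at x)"
  shows "f' x = 0" "D \<ge> 0"
proof -
  show zero: "f' x = 0"
    using x min by (intro DERIV_local_min[OF f'[OF x], of "min (x - a) (b - x)"]) auto
  show "D \<ge> 0"
  proof (rule ccontr)
    assume "\<not> D \<ge> 0"
    then obtain d where d: "d > 0" "\<And>h. 0 < h \<Longrightarrow> h < d \<Longrightarrow> f' (x + h) < f' x"
      using DERIV_neg_dec_right[OF f''] by force
    define y where "y = x + min d (b - x) / 2"
    have y: "x < y" "y < b" "y < x + d"
      using x d(1) by (auto simp: y_def min_def field_simps)
    have "f y < f x"
    proof (rule DERIV_neg_imp_decreasing_open[OF y(1)])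
      fix z assume z: "x < z" "z < y"
      have "f' (x + (z - x)) < f' x"
        using z y by (intro d(2)) auto
      then show "\<exists>D. (f has_real_derivative D) (at z) \<and> D < 0"
        using f'[of z] z x y zero by auto
      next
      show "continuous_on {x..y} f"
        using x y by (intro continuous_at_imp_continuous_on ballI DERIV_isCont[OF f']) auto
    qed
    with min[of y] x y show False by auto
  qed
qed

text \<open>
  In a maximum principle on a space-time cylinder the extremum may sit at the final time; only a sign
  of the time derivative is then available.
\<close>

lemma terminal_min_derivative:
  fixes f :: "real \<Rightarrow> real"
  assumes "(f has_real_derivative D) (at t)" "a < t" "\<And>s. a < s \<Longrightarrow> s < t \<Longrightarrow> f t \<le> f s"
  shows "D \<le> 0"
proof (rule ccontr)
  assume "\<not> D \<le> 0"
  then obtain d where d: "d > 0" "\<And>h. 0 < h \<Longrightarrow> h < d \<Longrightarrow> f (t - h) < f t"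
    using DERIV_pos_inc_left[OF assms(1)] by force
  define h where "h = min d (t - a) / 2"
  have "0 < h" "h < d" "a < t - h"
    using d(1) assms(2) by (auto simp: h_def min_def field_simps)
  then show False
    using d(2)[of h] assms(3)[of "t - h"] by auto
qed

lemma increment_le:
  fixes F :: "real \<Rightarrow> real"
  assumes "0 \<le> t" "continuous_on {0..} F"
    and F': "\<And>s. 0 < s \<Longrightarrow> s < t \<Longrightarrow> (F has_real_derivative F' s) (at s)"
    and le: "\<And>s. 0 < s \<Longrightarrow> s < t \<Longrightarrow> F' s \<le> c"
  shows "F t \<le> F 0 + c * t"
proof -
  have "c * 0 - F 0 \<le> c * t - F t"
  proof (rule DERIV_nonneg_imp_increasing_open[OF assms(1)])
    fix s assume s: "0 < s" "s < t"
    have "((\<lambda>s. c * s - F s) has_real_derivative c * 1 - F' s) (at s)"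
      by (intro DERIV_diff DERIV_cmult DERIV_ident F' s)
    then show "\<exists>y. ((\<lambda>s. c * s - F s) has_real_derivative y) (at s) \<and> 0 \<le> y"
      using le[OF s] by auto
  next
    show "continuous_on {0..t} (\<lambda>s. c * s - F s)"
      by (intro continuous_intros continuous_on_subset[OF assms(2)]) auto
  qed
  then show ?thesis by simp
qed

lemma C21_on_derivatives:
  assumes "C21_on A f" "(x, t) \<in> A"
  shows "((\<lambda>s. f x s) has_real_derivative Dt f x t) (at t)"
    and "((\<lambda>y. f y t) has_real_derivative Dx f x t) (at x)"
    and "((\<lambda>y. Dx f y t) has_real_derivative Dx (Dx f) x t) (at x)"
proof -
  have "(\<lambda>s. f x s) differentiable (at t)" "(\<lambda>y. f y t) differentiable (at x)"
    "(\<lambda>y. Dx f y t) differentiable (at x)"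
    using assms by (auto simp: C21_on_def)
  then show "((\<lambda>s. f x s) has_real_derivative Dt f x t) (at t)"
    and "((\<lambda>y. f y t) has_real_derivative Dx f x t) (at x)"
    and "((\<lambda>y. Dx f y t) has_real_derivative Dx (Dx f) x t) (at x)"
    unfolding Dt_def Dx_def[of "Dx f"] Dx_def[of f x]
    by (simp_all only: DERIV_deriv_iff_real_differentiable)
qed

section \<open>The Neumann problem\<close>

text \<open>
  The definition of a solution says nothing about \<open>u\<^sub>x\<close> near the boundary beyond its one-sided
  vanishing on it, so the mass cannot simply be differentiated in time. Instead \<open>u\<close> is compared with
  the explicit solution \<open>U\<close>. The perturbation \<open>- d (x - x\<^sup>2)\<close> gives \<open>z = U - u - \<dots>\<close> an inward slope \<open>- d\<close>
  at both ends, which excludes minima there, and \<open>3 d t\<close> outweighs its second derivative \<open>2 d\<close>, which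
  excludes minima inside. So the minimum is taken at time \<open>0\<close>.
\<close>

lemma neumann_solution_le:
  assumes u: "neumann_solution u" and x1: "x1 \<in> {0..1}" and t1: "t1 \<ge> 0"
  shows "u x1 t1 \<le> 1 + cos (2 * pi * x1) * exp (- 4 * pi\<^sup>2 * t1)"
proof -
  define U where "U x t = 1 + cos (2 * pi * x) * exp (- 4 * pi\<^sup>2 * t)" for x t :: real
  have "u x1 t1 \<le> U x1 t1 + e" if e: "e > 0" for e
  proof -
    \<comment> \<open>The final estimate loses \<open>d\<close> at time \<open>0\<close> and \<open>3 d t1\<close> from the perturbation.\<close>
    define d where "d = e / (1 + 3 * t1)"
    have d: "d > 0" using e t1 by (simp add: d_def)
    define z where "z x t = U x t - u x t - d * (x - x\<^sup>2) + 3 * d * t" for x t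
    have Ux: "((\<lambda>x. U x t) has_real_derivative - 2 * pi * sin (2 * pi * x) * exp (- 4 * pi\<^sup>2 * t)) (at x within X)"
      and Uxx: "((\<lambda>x. - 2 * pi * sin (2 * pi * x) * exp (- 4 * pi\<^sup>2 * t)) has_real_derivative
         - 4 * pi\<^sup>2 * (cos (2 * pi * x) * exp (- 4 * pi\<^sup>2 * t))) (at x)"
      and Ut: "((\<lambda>t. U x t) has_real_derivative
         - 4 * pi\<^sup>2 * (cos (2 * pi * x) * exp (- 4 * pi\<^sup>2 * t))) (at t)" for x t X
      unfolding U_def
      by (auto intro!: derivative_eq_intros simp: power2_eq_square)
    have cont: "continuous_on ({0..1} \<times> {0..t1}) (\<lambda>(x, t). z x t)"
    proof -
      have "continuous_on ({0..1} \<times> {0..t1}) (\<lambda>(x, t). u x t)"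
        using u by (auto simp: neumann_solution_def intro: continuous_on_subset)
      then show ?thesis
        unfolding z_def U_def case_prod_unfold by (intro continuous_intros)
    qed
    obtain x0 t0 where p: "x0 \<in> {0..1}" "t0 \<in> {0..t1}"
      and min: "\<And>x t. x \<in> {0..1} \<Longrightarrow> t \<in> {0..t1} \<Longrightarrow> z x0 t0 \<le> z x t"
    proof -
      have "\<exists>p\<in>{0..1} \<times> {0..t1}. \<forall>q\<in>{0..1} \<times> {0..t1}.
          (\<lambda>(x, t). z x t) p \<le> (\<lambda>(x, t). z x t) q"
        by (rule continuous_attains_inf[OF compact_Times _ cont]) (use t1 in auto)
      then show ?thesis using that by fastforce
    qed
    have "t0 = 0"
    proof (rule ccontr)
      assume "t0 \<noteq> 0"
      then have t0: "t0 > 0" using p by auto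
      have zx: "((\<lambda>x. z x t0) has_real_derivative
          - 2 * pi * sin (2 * pi * x) * exp (- 4 * pi\<^sup>2 * t0) - D - d * (1 - 2 * x)) (at x within X)"
        if "((\<lambda>x. u x t0) has_real_derivative D) (at x within X)" for x X D
        unfolding z_def by (rule derivative_eq_intros Ux that refl | simp)+
      consider "x0 = 0" | "x0 = 1" | "0 < x0" "x0 < 1" using p by force
      then show False
      proof cases
        case 1
        have "((\<lambda>x. z x t0) has_real_derivative - d) (at 0 within {0..1})"
          using zx[of 0 0 "{0..1}"] u t0 by (simp add: neumann_solution_def)
        from has_real_derivative_neg_dec_right[OF this] d
        obtain c where c: "c > 0" "\<And>h. h > 0 \<Longrightarrow> h \<in> {0..1} \<Longrightarrow> h < c \<Longrightarrow> z h t0 < z 0 t0"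
          by auto
        obtain h where "0 < h" "h < min c 1" using dense[of 0 "min c 1"] c(1) by auto
        then show False
          using c(2)[of h] min[of h t0] p 1 by auto
      next
        case 2
        have "((\<lambda>x. z x t0) has_real_derivative d) (at 1 within {0..1})"
          using zx[of 0 1 "{0..1}"] u t0 by (simp add: neumann_solution_def)
        from has_real_derivative_pos_inc_left[OF this] d
        obtain c where c: "c > 0" "\<And>h. h > 0 \<Longrightarrow> 1 - h \<in> {0..1} \<Longrightarrow> h < c \<Longrightarrow> z (1 - h) t0 < z 1 t0"
          by auto
        obtain h where "0 < h" "h < min c 1" using dense[of 0 "min c 1"] c(1) by auto
        then show False
          using c(2)[of h] min[of "1 - h" t0] p 2 by auto
      next
        case 3
        have ux: "((\<lambda>x. u x t0) has_real_derivative Dx u x t0) (at x)"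
          and uxx: "((\<lambda>x. Dx u x t0) has_real_derivative Dx (Dx u) x t0) (at x)"
          and ut: "((\<lambda>t. u x t) has_real_derivative Dx (Dx u) x t0) (at t0)" if "0 < x" "x < 1" for x
          using C21_on_derivatives[of "{0<..<1} \<times> {0<..}" u x t0] u t0 that
          by (auto simp: neumann_solution_def)
        have "- 4 * pi\<^sup>2 * (cos (2 * pi * x0) * exp (- 4 * pi\<^sup>2 * t0)) - Dx (Dx u) x0 t0 + 2 * d \<ge> 0"
        proof (rule interior_min_second_derivative(2)[of 0 x0 1 "\<lambda>x. z x t0"])
          show "((\<lambda>x. - 2 * pi * sin (2 * pi * x) * exp (- 4 * pi\<^sup>2 * t0) - Dx u x t0 - d * (1 - 2 * x))
             has_real_derivative - 4 * pi\<^sup>2 * (cos (2 * pi * x0) * exp (- 4 * pi\<^sup>2 * t0)) - Dx (Dx u) x0 t0 + 2 * d) (at x0)"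
            by (rule DERIV_cong, (rule DERIV_diff Uxx uxx 3 derivative_eq_intros refl)+) simp
        qed (use 3 min p zx ux in auto)
        moreover have "- 4 * pi\<^sup>2 * (cos (2 * pi * x0) * exp (- 4 * pi\<^sup>2 * t0)) - Dx (Dx u) x0 t0 + 3 * d \<le> 0"
        proof (rule terminal_min_derivative)
          show "((\<lambda>t. z x0 t) has_real_derivative
            - 4 * pi\<^sup>2 * (cos (2 * pi * x0) * exp (- 4 * pi\<^sup>2 * t0)) - Dx (Dx u) x0 t0 + 3 * d) (at t0)"
            unfolding z_def using 3 by (auto intro!: derivative_eq_intros Ut ut)
        qed (use t0 min p in auto)
        ultimately show False using d by auto
      qed
    qed
    moreover have "z x0 0 \<ge> - d"
    proof -
      have "z x0 0 = - (d * (x0 - x0\<^sup>2))"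
        using u p by (auto simp: z_def U_def neumann_solution_def u0_def)
      moreover have "x0 - x0\<^sup>2 \<le> 1" using p by (auto intro: order_trans[of _ x0])
      ultimately show ?thesis using d mult_left_mono[of "x0 - x0\<^sup>2" 1 d] by auto
    qed
    ultimately have "z x1 t1 \<ge> - d" using min[OF x1, of t1] t1 by auto
    moreover have "d * (x1 - x1\<^sup>2) \<ge> 0" 
      using d x1 by (auto intro!: mult_nonneg_nonneg simp: power2_eq_square mult_left_le)
    ultimately have "u x1 t1 \<le> U x1 t1 + d * (1 + 3 * t1)"
      by (auto simp: z_def algebra_simps)
    then show ?thesis using t1 by (simp add: d_def)
  qed
  then show ?thesis unfolding U_def by (rule field_le_epsilon)
qed

lemma neumann_solution_integrable:
  assumes "neumann_solution u" "t \<ge> 0"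
  shows "(\<lambda>x. u x t) integrable_on {0..1}"
proof (rule integrable_continuous_real)
  have "continuous_on {0..1} (\<lambda>x. (\<lambda>(x, t). u x t) (x, t))"
    by (rule continuous_on_compose2[of "{0..1} \<times> {0..}"])
      (use assms in \<open>auto simp: neumann_solution_def intro!: continuous_intros\<close>)
  then show "continuous_on {0..1} (\<lambda>x. u x t)" by simp
qed

lemma neumann_solution_mass_le:
  assumes u: "neumann_solution u" and t: "t \<ge> 0"
  shows "integral {0..1} (\<lambda>x. u x t) \<le> 1"
proof -
  have *: "((\<lambda>x. 1 + cos (2 * pi * x) * exp (- 4 * pi\<^sup>2 * t)) has_integral
     (1 + sin (2 * pi * 1) / (2 * pi) * exp (- 4 * pi\<^sup>2 * t)) - 
     (0 + sin (2 * pi * 0) / (2 * pi) * exp (- 4 * pi\<^sup>2 * t))) {0..1}"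
    by (intro fundamental_theorem_of_calculus)
      (auto intro!: derivative_eq_intros simp flip: has_real_derivative_iff_has_vector_derivative)
  from integral_le[OF neumann_solution_integrable[OF u t] has_integral_integrable[OF *]] neumann_solution_le[OF u _ t]
  have "integral {0..1} (\<lambda>x. u x t) \<le> integral {0..1} (\<lambda>x. 1 + cos (2 * pi * x) * exp (- 4 * pi\<^sup>2 * t))"
    by auto
  also have "\<dots> = 1" using integral_unique[OF *] by simp
  finally show ?thesis .
qed

section \<open>The drift equation\<close>

text \<open>
  Nonnegative data and the decay \<open>o(1/x\<^sup>2)\<close> suffice for the comparison principle and for the mass
  bound, so these are stated for any classical solution with its derivatives given explicitly.
\<close>

locale drift_equation =
  fixes N :: real and W Wx Wxx Wt :: "real \<Rightarrow> real \<Rightarrow> real"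
  assumes N_pos: "N > 0"
    and continuous_W: "continuous_on (UNIV \<times> {0..}) (\<lambda>(x, t). W x t)"
    and continuous_Wt: "continuous_on (UNIV \<times> {0<..}) (\<lambda>(x, t). Wt x t)"
    and DERIV_Wt: "t > 0 \<Longrightarrow> ((\<lambda>s. W x s) has_real_derivative Wt x t) (at t)"
    and DERIV_Wx: "t > 0 \<Longrightarrow> ((\<lambda>y. W y t) has_real_derivative Wx x t) (at x)"
    and DERIV_Wxx: "t > 0 \<Longrightarrow> ((\<lambda>y. Wx y t) has_real_derivative Wxx x t) (at x)"
    and equation: "t > 0 \<Longrightarrow> Wt x t = Wxx x t + N * drift x * Wx x t + N * drift' x * W x t"
    and initial_nonneg: "W x 0 \<ge> 0"
    and decay: "S > 0 \<Longrightarrow> uniform_limit {0..S} (\<lambda>x t. x\<^sup>2 * W x t) (\<lambda>_. 0) at_infinity"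
begin

lemma decay_bound:
  assumes "e > 0" "S > 0"
  obtains R where "R \<ge> 1" "\<And>x t. \<bar>x\<bar> \<ge> R \<Longrightarrow> t \<in> {0..S} \<Longrightarrow> x\<^sup>2 * \<bar>W x t\<bar> < e"
proof -
  from decay[OF assms(2)] assms(1)
  have "\<forall>\<^sub>F x in at_infinity. \<forall>t\<in>{0..S}. dist (x\<^sup>2 * W x t) 0 < e"
    unfolding uniform_limit_iff by blast
  then obtain b where "\<And>x t. norm x \<ge> b \<Longrightarrow> t \<in> {0..S} \<Longrightarrow> dist (x\<^sup>2 * W x t) 0 < e"
    unfolding eventually_at_infinity by blast
  then show thesis
    by (intro that[of "max 1 b"]) (auto simp: abs_mult)
qed

lemma continuous_slice: "t \<ge> 0 \<Longrightarrow> continuous_on A (\<lambda>x. W x t)"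
  using continuous_on_compose2[OF continuous_W, of A "\<lambda>x. (x, t)"]
  by (force intro: continuous_intros)

lemma integrable_slice:
  "t \<ge> 0 \<Longrightarrow> continuous_on {a..b} f \<Longrightarrow> (\<lambda>x. W x t * f x) integrable_on {a..b}"
  by (intro integrable_continuous_real continuous_intros continuous_slice)

text \<open>
  With \<open>g = 1 / (1 + x\<^sup>2)\<close>, the function \<open>exp ((6 N + 7) t) g\<close> is a strict supersolution. It decays
  exactly at the rate \<open>1/x\<^sup>2\<close> of solutions with a flux from infinity. A slower decay \<open>\<bar>x\<bar> powr (- p)\<close> would
  violate the inequality for large \<open>\<bar>x\<bar>\<close>, where \<open>N (\<Phi>' g)'\<close> behaves like
  \<open>(6 - 3 p) N \<bar>x\<bar> powr (1 - p)\<close>; a faster one would not dominate a general \<open>W = o(1/x\<^sup>2)\<close>.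
\<close>

lemma barrier_inequality:
  fixes x :: real
  defines "g \<equiv> 1 / (1 + x\<^sup>2)"
  shows "(6 * x\<^sup>2 - 2) * g ^ 3 + N * drift x * (- 2 * x * g\<^sup>2) + N * drift' x * g < (6 * N + 7) * g"
proof -
  have pos: "1 + x\<^sup>2 > 0" by (simp add: add_pos_nonneg)
  have g: "g > 0" "g * (1 + x\<^sup>2) = 1" using pos by (auto simp: g_def)
  have "(6 * x\<^sup>2 - 2) * g\<^sup>2 \<le> 6"
  proof -
    have "6 * x\<^sup>2 - 2 \<le> 6 * (1 + x\<^sup>2)\<^sup>2"
      by (simp add: power2_sum)
    then show ?thesis using pos by (simp add: g_def power_divide divide_simps)
  qed
  then have 1: "(6 * x\<^sup>2 - 2) * g\<^sup>2 * g \<le> 6 * g"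
    using g by (intro mult_right_mono) auto
  have "drift' x - 2 * x * drift x * g \<le> 6"
  proof -
    have "drift' x * (1 + x\<^sup>2) - 2 * x * drift x \<le> 6 * (1 + x\<^sup>2)"
    proof -
      consider "x \<le> 0" | "0 < x" "x \<le> 1" | "x > 1" by linarith
      then show ?thesis
      proof cases
        case 1
        have "0 \<le> 6 * ((x + 1/2)\<^sup>2 + 3/4)" by (simp add: add_nonneg_nonneg)
        then show ?thesis using 1 by (simp add: drift_cases drift'_cases power2_eq_square algebra_simps)
      next
        case 2
        then show ?thesis by (simp add: drift_cases drift'_cases)
      next
        case 3
        then show ?thesis by (simp add: drift_cases drift'_cases power2_eq_square algebra_simps)
      qed
    qed
    then show ?thesis using pos by (simp add: g_def divide_simps)
  qed
  then have 2: "N * (drift' x - 2 * x * drift x * g) * g \<le> N * 6 * g"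
    using g N_pos by (intro mult_right_mono mult_left_mono) auto
  show ?thesis
    using 1 2 g by (simp add: algebra_simps power2_eq_square power3_eq_cube)
qed

text \<open>
  Divide \<open>W\<close> by the supersolution. The quotient \<open>q\<close> tends to zero at infinity, because \<open>W = o(1/x\<^sup>2)\<close>, so a
  negative value would yield a negative minimum \<open>m\<close> at some point of a compact box and at a positive
  time. There \<open>W\<close> touches \<open>m\<close> times the supersolution from above, and since \<open>m < 0\<close> turns the
  strict supersolution into a strict subsolution, the equation is violated.
\<close>

lemma nonneg:
  assumes "t \<ge> 0"
  shows "W x t \<ge> 0"
proof (rule ccontr)
  define l where "l = 6 * N + 7"
  define q where "q x t = exp (- l * t) * (1 + x\<^sup>2) * W x t" for x t
  define g where "g x = 1 / (1 + x\<^sup>2)" for x :: real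
  have pos: "1 + x\<^sup>2 > 0" for x :: real by (simp add: add_pos_nonneg)
  then have nz: "1 + x\<^sup>2 \<noteq> 0" for x :: real by (metis less_irrefl)
  have Wq: "W x t = q x t * exp (l * t) * g x" for x t
  proof -
    have "exp (- l * t) * exp (l * t) = 1" "(1 + x\<^sup>2) * g x = 1"
      using nz[of x] by (simp_all add: g_def flip: exp_add)
    then show ?thesis unfolding q_def by algebra
  qed
  assume "\<not> W x t \<ge> 0"
  then have neg: "q x t < 0" using pos[of x] by (auto simp: q_def mult_pos_neg)
  have t: "t > 0"
    using \<open>\<not> W x t \<ge> 0\<close> initial_nonneg[of x] assms by (cases "t = 0") auto
  obtain R where R: "R \<ge> 1" "\<And>y s. \<bar>y\<bar> \<ge> R \<Longrightarrow> s \<in> {0..t} \<Longrightarrow> y\<^sup>2 * \<bar>W y s\<bar> < - q x t / 2"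
    using decay_bound[of "- q x t / 2" t] neg t by auto
  have far: "q y s > q x t" if "\<bar>y\<bar> \<ge> R" "s \<in> {0..t}" for y s
  proof -
    have "1 \<le> y\<^sup>2" using that(1) R(1) abs_le_square_iff[of 1 y] by simp
    then have "(1 + y\<^sup>2) * \<bar>W y s\<bar> \<le> (2 * y\<^sup>2) * \<bar>W y s\<bar>" by (intro mult_right_mono) auto
    also have "\<dots> < - q x t" using R(2)[OF that] by simp
    finally have "(1 + y\<^sup>2) * \<bar>W y s\<bar> < - q x t" .
    moreover have "\<bar>q y s\<bar> \<le> 1 * ((1 + y\<^sup>2) * \<bar>W y s\<bar>)"
      unfolding q_def abs_mult mult.assoc
      using that N_pos pos[of y] by (intro mult_mono) (auto simp: l_def intro: mult_nonpos_nonneg)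
    ultimately show ?thesis by linarith
  qed
  have x: "\<bar>x\<bar> < R" using far[of x t] t by force
  have cont: "continuous_on ({- R..R} \<times> {0..t}) (\<lambda>(x, t). q x t)"
  proof -
    have "continuous_on ({- R..R} \<times> {0..t}) (\<lambda>(x, t). W x t)"
      by (rule continuous_on_subset[OF continuous_W]) auto
    then show ?thesis
      unfolding q_def case_prod_unfold by (intro continuous_intros)
  qed
  obtain x0 t0 where p: "x0 \<in> {- R..R}" "t0 \<in> {0..t}"
    and min: "\<And>y s. y \<in> {- R..R} \<Longrightarrow> s \<in> {0..t} \<Longrightarrow> q x0 t0 \<le> q y s"
  proof -
    have "\<exists>p\<in>{- R..R} \<times> {0..t}. \<forall>r\<in>{- R..R} \<times> {0..t}.
        (\<lambda>(x, t). q x t) p \<le> (\<lambda>(x, t). q x t) r"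
      by (rule continuous_attains_inf[OF compact_Times _ cont]) (use t R in auto)
    then show ?thesis using that by fastforce
  qed
  define m where "m = q x0 t0"
  have m: "m \<le> q x t" using min[of x t] x t by (auto simp: m_def abs_less_iff)
  have x0: "\<bar>x0\<bar> < R" using far[of x0 t0] p m by (force simp: m_def)
  have t0: "t0 > 0"
  proof (rule ccontr)
    assume "\<not> t0 > 0"
    then have "q x0 t0 = (1 + x0\<^sup>2) * W x0 0" using p by (simp add: q_def)
    also have "\<dots> \<ge> 0" using initial_nonneg pos[of x0] by (intro mult_nonneg_nonneg) auto
    finally show False using m neg by (simp add: m_def)
  qed
  have ge: "W x0 t0 - m * exp (l * t0) * g x0 \<le> W y s - m * exp (l * s) * g y"
    if "y \<in> {- R..R}" "s \<in> {0..t}" for y s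
  proof -
    have "(q y s - m) * (exp (l * s) * g y) \<ge> 0"
      using min[OF that] pos[of y] by (intro mult_nonneg_nonneg) (auto simp: m_def g_def)
    then show ?thesis
      unfolding Wq[of y s] Wq[of x0 t0] m_def[symmetric] by (simp add: algebra_simps)
  qed
  have g1: "(g has_real_derivative - 2 * y * (g y)\<^sup>2) (at y)" for y
    unfolding g_def using nz[of y]
    by (auto intro!: derivative_eq_intros simp: power2_eq_square)
  have g2: "((\<lambda>y. - 2 * y * (g y)\<^sup>2) has_real_derivative (6 * y\<^sup>2 - 2) * g y ^ 3) (at y)" for y
  proof -
    have "((\<lambda>y. - 2 * y * (g y)\<^sup>2) has_real_derivative 
       - 2 * (g y)\<^sup>2 - 2 * y * (2 * g y * (- 2 * y * (g y)\<^sup>2))) (at y)"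
      by (auto intro!: derivative_eq_intros g1)
    moreover have "(g y)\<^sup>2 = (1 + y\<^sup>2) * g y ^ 3"
      using nz[of y] by (simp add: g_def power2_eq_square power3_eq_cube)
    then have "- 2 * (g y)\<^sup>2 - 2 * y * (2 * g y * (- 2 * y * (g y)\<^sup>2)) = (6 * y\<^sup>2 - 2) * g y ^ 3"
      by algebra
    ultimately show ?thesis by simp
  qed
  have Wx: "Wx x0 t0 - m * exp (l * t0) * (- 2 * x0 * (g x0)\<^sup>2) = 0"
    and Wxx: "Wxx x0 t0 - m * exp (l * t0) * ((6 * x0\<^sup>2 - 2) * g x0 ^ 3) \<ge> 0"
  proof -
    have 1: "((\<lambda>y. W y t0 - m * exp (l * t0) * g y) has_real_derivative
        Wx y t0 - m * exp (l * t0) * (- 2 * y * (g y)\<^sup>2)) (at y)" for y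
      by (intro DERIV_diff DERIV_cmult DERIV_Wx g1 t0)
    have 2: "((\<lambda>y. Wx y t0 - m * exp (l * t0) * (- 2 * y * (g y)\<^sup>2)) has_real_derivative
        Wxx x0 t0 - m * exp (l * t0) * ((6 * x0\<^sup>2 - 2) * g x0 ^ 3)) (at x0)"
      by (intro DERIV_diff DERIV_cmult DERIV_Wxx g2 t0)
    note * = interior_min_second_derivative[of "- R" x0 R, OF _ _ _ 1 2]
    show "Wx x0 t0 - m * exp (l * t0) * (- 2 * x0 * (g x0)\<^sup>2) = 0"
      by (rule *(1)) (use x0 ge p in auto)
    show "Wxx x0 t0 - m * exp (l * t0) * ((6 * x0\<^sup>2 - 2) * g x0 ^ 3) \<ge> 0"
      by (rule *(2)) (use x0 ge p in auto)
  qed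
  have Wt: "Wt x0 t0 - m * exp (l * t0) * (l * g x0) \<le> 0"
  proof (rule terminal_min_derivative)
    show "((\<lambda>s. W x0 s - m * exp (l * s) * g x0) has_real_derivative
        Wt x0 t0 - m * exp (l * t0) * (l * g x0)) (at t0)"
      by (auto intro!: derivative_eq_intros DERIV_Wt t0)
  qed (use t0 ge p in auto)
  define E where "E = m * exp (l * t0)"
  have "E < 0" using m neg by (simp add: E_def mult_neg_pos)
  have "Wx x0 t0 = E * (- 2 * x0 * (g x0)\<^sup>2)" "W x0 t0 = E * g x0"
    using Wx Wq[of x0 t0] by (simp_all add: E_def m_def)
  then have "Wt x0 t0 \<ge> E * ((6 * x0\<^sup>2 - 2) * g x0 ^ 3 + N * drift x0 * (- 2 * x0 * (g x0)\<^sup>2) + N * drift' x0 * g x0)"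
    using equation[OF t0, of x0] Wxx unfolding E_def[symmetric] by (simp add: algebra_simps)
  moreover have "E * ((6 * x0\<^sup>2 - 2) * g x0 ^ 3 + N * drift x0 * (- 2 * x0 * (g x0)\<^sup>2) + N * drift' x0 * g x0)
      > E * (l * g x0)"
    unfolding l_def g_def using \<open>E < 0\<close>
    by (intro mult_strict_left_mono_neg barrier_inequality)
  ultimately show False using Wt unfolding E_def by linarith
qed

text \<open>
  The weak formulation on an interval. The boundary term \<open>B\<close> collects the flux \<open>W\<^sub>x + N \<Phi>' W\<close> and the
  second integration by parts; it cancels between adjacent intervals when the test function is \<open>C\<^sup>1\<close>.
\<close>

lemma DERIV_moment:
  assumes t: "t > 0" and ab: "a \<le> b"
    and psi1: "\<And>x. (\<psi> has_real_derivative \<psi>' x) (at x)"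
    and psi2: "\<And>x. (\<psi>' has_real_derivative \<psi>'' x) (at x)"
    and cont: "continuous_on {a..b} \<psi>''"
  defines "B \<equiv> (\<lambda>x. (Wx x t + N * drift x * W x t) * \<psi> x - W x t * \<psi>' x)"
  shows "((\<lambda>t. integral {a..b} (\<lambda>x. W x t * \<psi> x)) has_real_derivative
    integral {a..b} (\<lambda>x. W x t * (\<psi>'' x - N * drift x * \<psi>' x)) + (B b - B a)) (at t)"
proof -
  have cpsi: "continuous_on A \<psi>" "continuous_on A \<psi>'" for A
    using psi1 psi2 by (auto intro!: continuous_at_imp_continuous_on DERIV_isCont)
  have "((\<lambda>t. integral (cbox a b) (\<lambda>x. W x t * \<psi> x)) has_real_derivative
     integral (cbox a b) (\<lambda>x. Wt x t * \<psi> x)) (at t within {0<..})"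
  proof (rule leibniz_rule_field_derivative)
    show "continuous_on ({0<..} \<times> cbox a b) (\<lambda>(t, x). Wt x t * \<psi> x)"
    proof -
      have "continuous_on ({0<..} \<times> cbox a b) (\<lambda>p. (\<lambda>(x, t). Wt x t) (snd p, fst p))"
        by (rule continuous_on_compose2[OF continuous_Wt]) (auto intro!: continuous_intros)
      moreover have "continuous_on ({0<..} \<times> cbox a b) (\<lambda>p. \<psi> (snd p))"
        by (rule continuous_on_compose2[OF cpsi(1)[of UNIV]]) (auto intro!: continuous_intros)
      ultimately show ?thesis
        unfolding case_prod_unfold by (auto intro: continuous_on_mult)
    qed
    show "((\<lambda>t. W x t * \<psi> x) has_field_derivative Wt x t * \<psi> x) (at t within {0<..})"
      if "t \<in> {0<..}" for x t
      by (rule has_field_derivative_at_within, rule DERIV_cmult_right, rule DERIV_Wt) (use that in auto)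
    show "(\<lambda>x. W x t * \<psi> x) integrable_on cbox a b" if "t \<in> {0<..}" for t
      using integrable_slice[of t a b \<psi>] that cpsi by auto
  qed (use t in auto)
  then have "((\<lambda>t. integral {a..b} (\<lambda>x. W x t * \<psi> x)) has_real_derivative
     integral {a..b} (\<lambda>x. Wt x t * \<psi> x)) (at t)"
    using t by (simp add: at_within_open[of t "{0<..}"])
  moreover have "integral {a..b} (\<lambda>x. Wt x t * \<psi> x) =
    integral {a..b} (\<lambda>x. W x t * (\<psi>'' x - N * drift x * \<psi>' x)) + (B b - B a)"
  proof -
    have "(B has_real_derivative
       (Wxx x t + (N * drift' x * W x t + N * drift x * Wx x t)) * \<psi> x + (Wx x t + N * drift x * W x t) * \<psi>' x
       - (Wx x t * \<psi>' x + W x t * \<psi>'' x)) (at x)" for x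
      unfolding B_def
      by (auto intro!: derivative_eq_intros DERIV_Wx DERIV_Wxx DERIV_drift psi1 psi2 t)
    then have "(B has_real_derivative Wt x t * \<psi> x - W x t * (\<psi>'' x - N * drift x * \<psi>' x)) (at x)" for x
      by (rule DERIV_cong) (simp add: equation[OF t] algebra_simps)
    then have "(B has_vector_derivative Wt x t * \<psi> x - W x t * (\<psi>'' x - N * drift x * \<psi>' x)) (at x within {a..b})" for x
      unfolding has_real_derivative_iff_has_vector_derivative[symmetric]
      by (rule has_field_derivative_at_within)
    from fundamental_theorem_of_calculus[OF ab this]
    have "((\<lambda>x. Wt x t * \<psi> x - W x t * (\<psi>'' x - N * drift x * \<psi>' x)) has_integral (B b - B a)) {a..b}"
      by blast
    from has_integral_add[OF this integrable_integral[OF integrable_slice],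
        of t "\<lambda>x. \<psi>'' x - N * drift x * \<psi>' x"]
    have "((\<lambda>x. Wt x t * \<psi> x) has_integral
       B b - B a + integral {a..b} (\<lambda>x. W x t * (\<psi>'' x - N * drift x * \<psi>' x))) {a..b}"
      using t by (simp add: cpsi cont continuous_intros)
    then show ?thesis by (simp add: integral_unique add.commute)
  qed
  ultimately show ?thesis by simp
qed

lemma continuous_on_moment:
  assumes "continuous_on UNIV \<psi>"
  shows "continuous_on {0..} (\<lambda>t. integral {a..b} (\<lambda>x. W x t * \<psi> x))"
proof -
  have "continuous_on ({0..} \<times> cbox a b) (\<lambda>(t, x). W x t * \<psi> x)"
  proof -
    have "continuous_on ({0..} \<times> cbox a b) (\<lambda>p. (\<lambda>(x, t). W x t) (snd p, fst p))"
      by (rule continuous_on_compose2[OF continuous_W]) (auto intro!: continuous_intros)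
    moreover have "continuous_on ({0..} \<times> cbox a b) (\<lambda>p. \<psi> (snd p))"
      by (rule continuous_on_compose2[OF assms]) (auto intro!: continuous_intros)
    ultimately show ?thesis
      unfolding case_prod_unfold by (auto intro: continuous_on_mult)
  qed
  from integral_continuous_on_param[OF this] show ?thesis by simp
qed

text \<open>
  No mass enters from infinity. The test function \<open>(1 - x\<^sup>2/R\<^sup>2)\<^sup>2\<close> on \<open>[-R, R]\<close> vanishes to second order
  at the ends, and the adjoint operator maps it to at most \<open>(8 + 12 N \<bar>x\<bar>\<^sup>3) / R\<^sup>2\<close>. Against
  \<open>W = o(1/x\<^sup>2)\<close> this is \<open>o(1/R)\<close> uniformly on \<open>[-R, R]\<close>, hence it integrates to \<open>o(1)\<close>.
\<close>

lemma mass_le: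
  assumes M: "\<And>R. R > 0 \<Longrightarrow> integral {- R..R} (\<lambda>x. W x 0) \<le> M" and t: "t \<ge> 0"
  shows "integral {a..b} (\<lambda>x. W x t) \<le> M"
proof -
  define I where "I = integral {a..b} (\<lambda>x. W x t)"
  define r where "r = max \<bar>a\<bar> \<bar>b\<bar>"
  define c where "c = 2 * (9 + 12 * N) * t"
  have c: "c \<ge> 0" using t N_pos by (simp add: c_def)
  have main: "I \<le> M + c * e" if e: "e > 0" for e
  proof -
    obtain K where K: "K \<ge> 1" "\<And>x s. \<bar>x\<bar> \<ge> K \<Longrightarrow> s \<in> {0..t + 1} \<Longrightarrow> x\<^sup>2 * \<bar>W x s\<bar> < e"
      using decay_bound[OF e, of "t + 1"] t by auto
    have "compact ((\<lambda>(x, s). W x s) ` ({- K..K} \<times> {0..t}))"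
      by (intro compact_continuous_image continuous_on_subset[OF continuous_W] compact_Times) auto
    then have "bounded ((\<lambda>(x, s). W x s) ` ({- K..K} \<times> {0..t}))"
      by (rule compact_imp_bounded)
    then obtain C0 where "\<forall>z\<in>(\<lambda>(x, s). W x s) ` ({- K..K} \<times> {0..t}). norm z \<le> C0"
      unfolding bounded_iff by blast
    then have C0: "\<And>x s. x \<in> {- K..K} \<Longrightarrow> s \<in> {0..t} \<Longrightarrow> norm (W x s) \<le> C0"
      by fastforce
    define C where "C = max 0 C0"
    have C: "W x s \<le> C" if "\<bar>x\<bar> \<le> K" "s \<in> {0..t}" for x s
      using C0[of x s] that by (auto simp: C_def abs_le_iff)
    have C_nonneg: "C \<ge> 0" by (simp add: C_def)
    have cutoff: "(1 - r\<^sup>2 / R\<^sup>2)\<^sup>2 * I \<le> M + c * e"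
      if R: "R \<ge> K" "R \<ge> r" "R \<ge> C * (8 + 12 * N * K ^ 3) / e" for R
    proof -
      have R0: "R > 0" using R K by simp
      define i where "i = 1 / R\<^sup>2"
      have i: "i > 0" "i * R\<^sup>2 = 1" using R0 by (auto simp: i_def)
      have ix: "0 \<le> i * x\<^sup>2" "i * x\<^sup>2 \<le> 1" if "\<bar>x\<bar> \<le> R" for x
      proof -
        have "x\<^sup>2 \<le> R\<^sup>2" using that by (simp add: abs_le_square_iff[symmetric])
        then have "i * x\<^sup>2 \<le> i * R\<^sup>2" using i by (intro mult_left_mono) auto
        then show "i * x\<^sup>2 \<le> 1" using i by simp
      qed (use i in auto)
      define \<eta> \<eta>' \<eta>'' where "\<eta> x = (1 - i * x\<^sup>2)\<^sup>2" and "\<eta>' x = - 4 * i * x * (1 - i * x\<^sup>2)"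
        and "\<eta>'' x = - 4 * i + 12 * i * (i * x\<^sup>2)" for x :: real
      have D: "(\<eta> has_real_derivative \<eta>' x) (at x)" "(\<eta>' has_real_derivative \<eta>'' x) (at x)" for x
        unfolding \<eta>_def \<eta>'_def \<eta>''_def
        by (auto intro!: derivative_eq_intros simp: algebra_simps power2_eq_square)
      have cont: "continuous_on A \<eta>" "continuous_on A \<eta>'" "continuous_on A \<eta>''" for A
        unfolding \<eta>_def \<eta>'_def \<eta>''_def by (intro continuous_intros)+
      have at_R: "\<eta> R = 0" "\<eta> (- R) = 0" "\<eta>' R = 0" "\<eta>' (- R) = 0"
        using i by (simp_all add: \<eta>_def \<eta>'_def)
      have generator: "\<eta>'' x - N * drift x * \<eta>' x \<le> i * (8 + 12 * N * \<bar>x\<bar> ^ 3)" if x: "\<bar>x\<bar> \<le> R" for x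
      proof -
        have "\<eta>'' x \<le> i * 8" 
          using mult_left_mono[OF ix(2)[OF x], of "12 * i"] i by (simp add: \<eta>''_def)
        moreover have "\<bar>N * drift x * \<eta>' x\<bar> \<le> (N * (3 * x\<^sup>2)) * (4 * i * \<bar>x\<bar> * 1)"
          unfolding abs_mult[of "N * drift x"] \<eta>'_def
          using N_pos i ix[OF x] abs_drift_le[of x]
          by (intro mult_mono) (auto simp: abs_mult intro!: mult_left_le)
        ultimately show ?thesis
          by (simp add: algebra_simps power2_eq_square power3_eq_cube)
      qed
      \<comment> \<open>The decay of \<open>W\<close> is used for \<open>\<bar>x\<bar> > K\<close>; on the fixed compact part a large \<open>R\<close> is enough.\<close>
      have small: "W x s * (\<eta>'' x - N * drift x * \<eta>' x) \<le> (9 + 12 * N) * e / R"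
        if x: "\<bar>x\<bar> \<le> R" and s: "s \<in> {0..t}" for x s
      proof -
        have W: "W x s \<ge> 0" using nonneg s by auto
        have "W x s * (\<eta>'' x - N * drift x * \<eta>' x) \<le> W x s * (i * (8 + 12 * N * \<bar>x\<bar> ^ 3))"
          by (intro mult_left_mono generator x W)
        also have "\<dots> \<le> (9 + 12 * N) * e / R"
        proof (cases "\<bar>x\<bar> \<le> K")
          case True
          have "W x s * (i * (8 + 12 * N * \<bar>x\<bar> ^ 3)) \<le> C * (i * (8 + 12 * N * K ^ 3))"
            using True C[OF True s] W i N_pos C_nonneg
            by (intro mult_mono add_mono power_mono) (auto intro!: mult_nonneg_nonneg add_nonneg_nonneg)
          also have "\<dots> = (C * (8 + 12 * N * K ^ 3) / e) * (e * i)" using e by simp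
          also have "\<dots> \<le> R * (e * i)" using R(3) e i by (intro mult_right_mono) auto
          also have "\<dots> = 1 * e / R" using R0 by (simp add: i_def power2_eq_square)
          also have "\<dots> \<le> (9 + 12 * N) * e / R"
            using e R0 N_pos by (intro divide_right_mono mult_right_mono) auto
          finally show ?thesis .
        next
          case False
          then have "\<bar>x\<bar> \<ge> 1" using K by auto
          then have "8 + 12 * N * \<bar>x\<bar> ^ 3 \<le> (8 + 12 * N) * \<bar>x\<bar> ^ 3"
            using one_le_power[of "\<bar>x\<bar>" 3] by (simp add: algebra_simps)
          then have "W x s * (i * (8 + 12 * N * \<bar>x\<bar> ^ 3)) \<le> W x s * (i * ((8 + 12 * N) * \<bar>x\<bar> ^ 3))"
            using W i by (intro mult_left_mono) auto
          also have "\<dots> = (x\<^sup>2 * \<bar>W x s\<bar>) * (i * (8 + 12 * N) * \<bar>x\<bar>)"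
            unfolding power2_abs[of x, symmetric] power2_eq_square power3_eq_cube
            using W by (simp only: abs_of_nonneg mult_ac)
          also have "\<dots> \<le> e * (i * (9 + 12 * N) * R)"
            using K(2)[of x s] s False x i N_pos e by (intro mult_mono) auto
          also have "\<dots> = (9 + 12 * N) * e / R" using R0 by (simp add: i_def power2_eq_square)
          finally show ?thesis .
        qed
        finally show ?thesis .
      qed
      have "integral {- R..R} (\<lambda>x. W x t * \<eta> x) \<le> integral {- R..R} (\<lambda>x. W x 0 * \<eta> x) + 2 * (9 + 12 * N) * e * t"
      proof (rule increment_le[OF t continuous_on_moment[OF cont(1)]])
        fix s assume s: "0 < s" "s < t"
        show "((\<lambda>s. integral {- R..R} (\<lambda>x. W x s * \<eta> x)) has_real_derivative
           integral {- R..R} (\<lambda>x. W x s * (\<eta>'' x - N * drift x * \<eta>' x))) (at s)"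
          using DERIV_moment[OF s(1) _ D cont(3), of "- R" R] R0 at_R by simp
        have "integral {- R..R} (\<lambda>x. W x s * (\<eta>'' x - N * drift x * \<eta>' x))
            \<le> integral {- R..R} (\<lambda>x. (9 + 12 * N) * e / R)"
          using s by (intro integral_le integrable_slice small continuous_intros cont) auto
        also have "\<dots> = 2 * (9 + 12 * N) * e" using R0 by simp
        finally show "integral {- R..R} (\<lambda>x. W x s * (\<eta>'' x - N * drift x * \<eta>' x)) \<le> 2 * (9 + 12 * N) * e" .
      qed
      moreover have "integral {- R..R} (\<lambda>x. W x 0 * \<eta> x) \<le> integral {- R..R} (\<lambda>x. W x 0)"
      proof (intro integral_le integrable_slice cont integrable_continuous_real continuous_slice)
        fix x assume "x \<in> {- R..R}"
        then have "\<eta> x \<le> 1" unfolding \<eta>_def using ix[of x] by (intro power_le_one) auto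
        then show "W x 0 * \<eta> x \<le> W x 0" using nonneg[of 0 x] by (intro mult_left_le) auto
      qed auto
      moreover have "(1 - r\<^sup>2 / R\<^sup>2)\<^sup>2 * I \<le> integral {- R..R} (\<lambda>x. W x t * \<eta> x)"
      proof -
        have "(1 - r\<^sup>2 / R\<^sup>2)\<^sup>2 * I = integral {a..b} (\<lambda>x. W x t * (1 - r\<^sup>2 / R\<^sup>2)\<^sup>2)"
          by (simp add: I_def)
        also have "\<dots> \<le> integral {a..b} (\<lambda>x. W x t * \<eta> x)"
        proof (intro integral_le integrable_slice cont t)
          fix x assume x: "x \<in> {a..b}"
          then have "\<bar>x\<bar> \<le> \<bar>r\<bar>" by (auto simp: r_def)
          then have "i * x\<^sup>2 \<le> i * r\<^sup>2" using i by (intro mult_left_mono) (auto simp: abs_le_square_iff)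
          moreover have "i * r\<^sup>2 \<le> 1" using ix(2)[of r] R(2) by (auto simp: r_def)
          ultimately have "(1 - i * r\<^sup>2)\<^sup>2 \<le> \<eta> x" unfolding \<eta>_def by (intro power_mono) auto
          then show "W x t * (1 - r\<^sup>2 / R\<^sup>2)\<^sup>2 \<le> W x t * \<eta> x"
            using nonneg[OF t] by (intro mult_left_mono) (auto simp: i_def)
        qed auto
        also have "\<dots> \<le> integral {- R..R} (\<lambda>x. W x t * \<eta> x)"
          using R(2) nonneg[OF t] by (intro integral_subset_le integrable_slice cont t) (auto simp: r_def \<eta>_def)
        finally show ?thesis .
      qed
      ultimately show ?thesis using M[OF R0] by (simp add: c_def mult.commute mult.left_commute)
    qed
    have lim: "((\<lambda>R. (1 - r\<^sup>2 / R\<^sup>2)\<^sup>2 * I) \<longlongrightarrow> (1 - 0)\<^sup>2 * I) at_top"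
    proof (intro tendsto_intros)
      show "((\<lambda>R. r\<^sup>2 / R\<^sup>2) \<longlongrightarrow> 0) at_top"
        by (intro tendsto_divide_0[OF tendsto_const] filterlim_at_top_imp_at_infinity
            filterlim_pow_at_top filterlim_ident) auto
    qed
    have "(1 - 0)\<^sup>2 * I \<le> M + c * e"
    proof (rule tendsto_upperbound[OF lim])
      show "\<forall>\<^sub>F R in at_top. (1 - r\<^sup>2 / R\<^sup>2)\<^sup>2 * I \<le> M + c * e"
        using eventually_ge_at_top[of K] eventually_ge_at_top[of r]
          eventually_ge_at_top[of "C * (8 + 12 * N * K ^ 3) / e"]
        by eventually_elim (rule cutoff)
    qed auto
    then show ?thesis by simp
  qed
  have "I \<le> M"
  proof (rule field_le_epsilon)
    fix e :: real assume e: "e > 0"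
    have "c * (e / (c + 1)) \<le> e" using c e by (simp add: field_simps)
    then show "I \<le> M + e" using main[of "e / (c + 1)"] e c by auto
  qed
  then show ?thesis by (simp add: I_def)
qed

text \<open>
  The pieces \<open>p\<close>, \<open>q\<close>, \<open>r\<close> form the \<open>C\<^sup>1\<close> bump \<open>\<theta>\<close> on \<open>[-l, 1 + l]\<close>. Inside \<open>[0, 1]\<close> there is no drift, so
  \<open>\<theta>'' = -2\<close> makes \<open>\<integral> W \<theta>\<close> decrease at twice the mass found there; outside, at most the mass
  \<open>e\<close> works against this, with the factor \<open>1/l + 3 N l\<^sup>2\<close>. The decrease during the unit time cannot
  exceed the initial value of \<open>\<integral> W \<theta>\<close>.
\<close>

lemma interior_defect_lower_bound:
  assumes l: "0 < l" "l \<le> 1"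
    and initial_mass: "integral {0..1} (\<lambda>x. W x 0) = 1"
    and initial_support: "\<And>x. x \<notin> {0..1} \<Longrightarrow> W x 0 = 0"
    and mass: "\<And>t. t > 0 \<Longrightarrow> integral {- l..1 + l} (\<lambda>x. W x t) \<le> 1"
    and inside: "\<And>t. 0 < t \<Longrightarrow> t < 1 \<Longrightarrow> integral {0..1} (\<lambda>x. W x t) \<ge> 1 - e"
  shows "5 / 4 \<le> (2 + 1 / l + 3 * N * l\<^sup>2) * e"
proof -
  define k where "k = 1 / l + 3 * N * l\<^sup>2"
  define p q r where "p x = (x + l)\<^sup>2 / (2 * l)" and "q x = l / 2 + x - x\<^sup>2"
    and "r x = (1 + l - x)\<^sup>2 / (2 * l)" for x :: real
  define p' q' r' where "p' x = (x + l) / l" and "q' x = 1 - 2 * x"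
    and "r' x = - (1 + l - x) / l" for x :: real
  have D: "(p has_real_derivative p' x) (at x)" "(p' has_real_derivative 1 / l) (at x)"
    "(q has_real_derivative q' x) (at x)" "(q' has_real_derivative - 2) (at x)"
    "(r has_real_derivative r' x) (at x)" "(r' has_real_derivative 1 / l) (at x)" for x
    unfolding p_def p'_def q_def q'_def r_def r'_def
    using l by (auto intro!: derivative_eq_intros simp: divide_simps)
  have cont: "continuous_on A p" "continuous_on A q" "continuous_on A r"
     "continuous_on A p'" "continuous_on A q'" "continuous_on A r'" for A
    using D by (auto intro!: continuous_at_imp_continuous_on DERIV_isCont)
  define P Q R where "P t = integral {- l..0} (\<lambda>x. W x t * p x)"
    and "Q t = integral {0..1} (\<lambda>x. W x t * q x)"
    and "R t = integral {1..1 + l} (\<lambda>x. W x t * r x)" for t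
  define m where "m a b t = integral {a..b} (\<lambda>x. W x t)" for a b t
  have mc: "integral {a..b} (\<lambda>x. W x t * z) = z * m a b t" for a b t z
    by (simp add: m_def)
  define P' R' where "P' t = integral {- l..0} (\<lambda>x. W x t * (1 / l - N * drift x * p' x))"
    and "R' t = integral {1..1 + l} (\<lambda>x. W x t * (1 / l - N * drift x * r' x))" for t
  have increment: "P 1 + Q 1 + R 1 \<le> P 0 + Q 0 + R 0 + (k * e - 2 * (1 - e)) * 1"
  proof (rule increment_le[where F = "\<lambda>t. P t + Q t + R t"])
    show "continuous_on {0..} (\<lambda>t. P t + Q t + R t)"
      unfolding P_def Q_def R_def by (intro continuous_intros continuous_on_moment cont)
    fix t :: real assume t: "0 < t" "t < 1"
    define B where "B = (\<lambda>\<psi> \<psi>' x. (Wx x t + N * drift x * W x t) * \<psi> x - W x t * \<psi>' x)"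
    have "(P has_real_derivative P' t + (B p p' 0 - B p p' (- l))) (at t)"
      unfolding P_def P'_def B_def
      by (rule DERIV_moment[OF t(1) _ D(1,2)]) (use l in auto)
    moreover have "(Q has_real_derivative - 2 * m 0 1 t + (B q q' 1 - B q q' 0)) (at t)"
    proof -
      have "integral {0..1} (\<lambda>x. W x t * (- 2 - N * drift x * q' x)) = integral {0..1} (\<lambda>x. W x t * (- 2))"
        by (rule integral_cong) (simp add: drift_inside)
      then show ?thesis
        using DERIV_moment[OF t(1) _ D(3,4), of 0 1] unfolding Q_def B_def mc by simp
    qed
    moreover have "(R has_real_derivative R' t + (B r r' (1 + l) - B r r' 1)) (at t)"
      unfolding R_def R'_def B_def
      by (rule DERIV_moment[OF t(1) _ D(5,6)]) (use l in auto)
    \<comment> \<open>The values and slopes of adjacent pieces agree, and both vanish at the outer ends.\<close>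
    moreover have "B p p' (- l) = 0" "B r r' (1 + l) = 0" "B p p' 0 = B q q' 0" "B q q' 1 = B r r' 1"
      using l by (simp_all add: B_def p_def p'_def q_def q'_def r_def r'_def power2_eq_square)
    ultimately show "((\<lambda>t. P t + Q t + R t) has_real_derivative P' t + (- 2 * m 0 1 t) + R' t) (at t)"
      by (auto intro!: derivative_eq_intros)
    have generator: "1 / l - N * d * s \<le> k" if "\<bar>d\<bar> \<le> 3 * l\<^sup>2" "\<bar>s\<bar> \<le> 1" for d s
    proof -
      have "\<bar>N * d * s\<bar> \<le> N * (3 * l\<^sup>2) * 1"
        unfolding abs_mult using that N_pos by (intro mult_mono) auto
      then show ?thesis by (simp add: k_def)
    qed
    have "P' t \<le> integral {- l..0} (\<lambda>x. W x t * k)"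
      unfolding P'_def
    proof (intro integral_le integrable_slice continuous_intros cont)
      fix x assume x: "x \<in> {- l..0}"
      then have "x\<^sup>2 \<le> l\<^sup>2" by (intro power2_le_iff_abs_le[THEN iffD2]) (use l in auto)
      then have "1 / l - N * drift x * p' x \<le> k"
        using x l by (intro generator) (auto simp: drift_cases p'_def)
      then show "W x t * (1 / l - N * drift x * p' x) \<le> W x t * k"
        using nonneg t by (intro mult_left_mono) auto
    qed (use t in auto)
    moreover have "R' t \<le> integral {1..1 + l} (\<lambda>x. W x t * k)"
      unfolding R'_def
    proof (intro integral_le integrable_slice continuous_intros cont)
      fix x assume x: "x \<in> {1..1 + l}"
      then have "(x - 1)\<^sup>2 \<le> l\<^sup>2" by (intro power_mono) auto
      then have "1 / l - N * drift x * r' x \<le> k"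
        using x l by (intro generator) (auto simp: drift_cases r'_def)
      then show "W x t * (1 / l - N * drift x * r' x) \<le> W x t * k"
        using nonneg t by (intro mult_left_mono) auto
    qed (use t in auto)
    ultimately have "P' t + R' t \<le> k * (m (- l) 0 t + m 1 (1 + l) t)"
      unfolding mc by (simp add: distrib_left)
    also have "m (- l) 0 t + m 1 (1 + l) t \<le> e"
    proof -
      have int: "(\<lambda>x. W x t) integrable_on {a..b}" for a b
        using t by (intro integrable_continuous_real continuous_slice) auto
      have "m (- l) 0 t + m 0 1 t = m (- l) 1 t" "m (- l) 1 t + m 1 (1 + l) t = m (- l) (1 + l) t"
        unfolding m_def using l by (auto intro!: Henstock_Kurzweil_Integration.integral_combine int)
      then show ?thesis using mass[of t] inside[of t] t by (simp add: m_def)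
    qed
    finally have "P' t + R' t \<le> k * e" using l N_pos by (simp add: k_def mult_left_mono)
    then show "P' t + (- 2 * m 0 1 t) + R' t \<le> k * e - 2 * (1 - e)"
      using inside[OF t] by (simp add: m_def)
  qed auto
  have final: "P 1 \<ge> 0" "Q 1 \<ge> 0" "R 1 \<ge> 0"
    unfolding P_def Q_def R_def
  proof -
    show "integral {- l..0} (\<lambda>x. W x 1 * p x) \<ge> 0" "integral {1..1 + l} (\<lambda>x. W x 1 * r x) \<ge> 0"
      using l by (intro integral_nonneg integrable_slice cont mult_nonneg_nonneg nonneg;
          simp add: p_def r_def)+
    show "integral {0..1} (\<lambda>x. W x 1 * q x) \<ge> 0"
    proof (intro integral_nonneg integrable_slice cont)
      fix x :: real assume x: "x \<in> {0..1}"
      then have "x * x \<le> x * 1" by (intro mult_left_mono) auto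
      then have "q x \<ge> 0" using l by (simp add: q_def power2_eq_square)
      then show "0 \<le> W x 1 * q x" using nonneg by simp
    qed auto
  qed
  have "P 0 = integral {- l..0} (\<lambda>x. 0)"
    unfolding P_def
  proof (rule integral_spike[of "{0}"])
    show "\<And>x. x \<in> {- l..0} - {0} \<Longrightarrow> 0 = W x 0 * p x" using initial_support by auto
  qed auto
  moreover have "R 0 = integral {1..1 + l} (\<lambda>x. 0)"
    unfolding R_def
  proof (rule integral_spike[of "{1}"])
    show "\<And>x. x \<in> {1..1 + l} - {1} \<Longrightarrow> 0 = W x 0 * r x" using initial_support by auto
  qed auto
  moreover have "Q 0 \<le> (l / 2 + 1 / 4) * m 0 1 0"
    unfolding Q_def mc[symmetric]
  proof (intro integral_le integrable_slice cont continuous_intros)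
    fix x :: real
    have "x - x\<^sup>2 \<le> 1 / 4" using zero_le_power2[of "x - 1 / 2"] by (simp add: power2_eq_square algebra_simps)
    then have "q x \<le> l / 2 + 1 / 4" by (simp add: q_def)
    then show "W x 0 * q x \<le> W x 0 * (l / 2 + 1 / 4)" using nonneg by (intro mult_left_mono) auto
  qed auto
  ultimately show ?thesis
    using increment final initial_mass l unfolding add.assoc k_def[symmetric]
    by (simp add: m_def distrib_right)
qed

end

section \<open>The deficit with respect to the Gibbs state\<close>

lemma square_times_gibbs_tendsto_0:
  assumes "N > 0"
  shows "((\<lambda>x. x\<^sup>2 * (2 * exp (- N * \<Phi> x))) \<longlongrightarrow> 0) at_infinity"
proof (rule Lim_null_comparison)
  show "\<forall>\<^sub>F x in at_infinity. norm (x\<^sup>2 * (2 * exp (- N * \<Phi> x))) \<le> 16 / N * inverse (norm x)"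
    unfolding eventually_at_infinity
  proof (intro exI[of _ 2] allI impI)
    fix x :: real assume x: "2 \<le> norm x"
    have "(\<bar>x\<bar> / 2) ^ 3 \<le> \<Phi> x"
      using x power_mono[of "\<bar>x\<bar> / 2" "\<bar>x\<bar>" 3] power_mono[of "\<bar>x\<bar> / 2" "\<bar>x - 1\<bar>" 3]
      by (cases "x \<le> 0") (simp_all add: \<Phi>_def)
    then have "N * (\<bar>x\<bar> ^ 3 / 8) \<le> N * \<Phi> x"
      using assms by (intro mult_left_mono) (auto simp: power_divide)
    also have "\<dots> \<le> exp (N * \<Phi> x)"
      using exp_ge_add_one_self[of "N * \<Phi> x"] by linarith
    finally have le: "N * (\<bar>x\<bar> ^ 3 / 8) \<le> exp (N * \<Phi> x)" .
    have pos: "N * (\<bar>x\<bar> ^ 3 / 8) > 0" using assms x by auto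
    have "exp (- N * \<Phi> x) = inverse (exp (N * \<Phi> x))" by (simp add: exp_minus)
    also have "\<dots> \<le> inverse (N * (\<bar>x\<bar> ^ 3 / 8))" by (rule le_imp_inverse_le[OF le pos])
    finally have "x\<^sup>2 * (2 * exp (- N * \<Phi> x)) \<le> x\<^sup>2 * (2 * inverse (N * (\<bar>x\<bar> ^ 3 / 8)))"
      by (intro mult_left_mono) auto
    also have "\<dots> = 16 / N * inverse (norm x)"
    proof -
      have "y\<^sup>2 * (2 * inverse (N * (y ^ 3 / 8))) = 16 / N * inverse y" if "y > 0" for y
        using that assms by (simp add: field_simps power2_eq_square power3_eq_cube)
      from this[of "\<bar>x\<bar>"] x show ?thesis by simp
    qed
    finally have "x\<^sup>2 * (2 * exp (- N * \<Phi> x)) \<le> 16 / N * inverse (norm x)" .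
    then show "norm (x\<^sup>2 * (2 * exp (- N * \<Phi> x))) \<le> 16 / N * inverse (norm x)"
      by simp
  qed
  show "((\<lambda>x::real. 16 / N * inverse (norm x)) \<longlongrightarrow> 0) at_infinity"
    by (intro tendsto_mult_right_zero filterlim_compose[OF tendsto_inverse_0]
        filterlim_at_top_imp_at_infinity filterlim_norm_at_top)
qed

lemma gibbs_deficit_initial:
  assumes "drift_solution N v"
  shows "2 * exp (- N * \<Phi> x) - v x 0 = (if x \<in> {0..1} then 1 - cos (2 * pi * x) else 0)"
  using assms by (auto simp: drift_solution_def v0_def \<Phi>_def power3_eq_cube)

lemma gibbs_deficit_drift_equation:
  assumes N: "N > 0" and v: "drift_solution N v"
  defines "E \<equiv> (\<lambda>x. 2 * exp (- N * \<Phi> x))"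
  shows "drift_equation N (\<lambda>x t. E x - v x t) (\<lambda>x t. - N * drift x * E x - Dx v x t)
    (\<lambda>x t. - N * drift' x * E x + (N * drift x)\<^sup>2 * E x - Dx (Dx v) x t) (\<lambda>x t. - Dt v x t)"
proof
  have E1: "(E has_real_derivative - N * drift x * E x) (at x)" for x
    unfolding E_def by (auto intro!: derivative_eq_intros DERIV_Phi)
  have E2: "((\<lambda>x. - N * drift x * E x) has_real_derivative
      - N * drift' x * E x + (N * drift x)\<^sup>2 * E x) (at x)" for x
    by (rule DERIV_cong, (rule derivative_eq_intros DERIV_drift E1 refl)+) (simp add: power2_eq_square)
  have cE: "continuous_on A E" for A
    using E1 by (auto intro!: continuous_at_imp_continuous_on DERIV_isCont)
  have C21: "C21_on (UNIV \<times> {0<..}) v" using v by (simp add: drift_solution_def)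
  note D = C21_on_derivatives[OF C21]
  show "N > 0" by (rule N)
  show "continuous_on (UNIV \<times> {0..}) (\<lambda>(x, t). E x - v x t)"
  proof -
    have "continuous_on (UNIV \<times> {0..}) (\<lambda>(x, t). v x t)" using v by (simp add: drift_solution_def)
    moreover have "continuous_on (UNIV \<times> {0..}) (\<lambda>p::real\<times>real. E (fst p))"
      by (rule continuous_on_compose2[OF cE[of UNIV]]) (auto intro: continuous_intros)
    ultimately show ?thesis unfolding case_prod_unfold by (intro continuous_on_diff)
  qed
  show "continuous_on (UNIV \<times> {0<..}) (\<lambda>(x, t). - Dt v x t)"
    using C21 unfolding C21_on_def case_prod_unfold by (intro continuous_on_minus) auto
  show "((\<lambda>s. E x - v x s) has_real_derivative - Dt v x t) (at t)" if "t > 0" for x t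
    using DERIV_diff[OF DERIV_const D(1)[of x t]] that by simp
  show "((\<lambda>y. E y - v y t) has_real_derivative - N * drift x * E x - Dx v x t) (at x)" if "t > 0" for x t
    using that by (intro DERIV_diff E1 D) auto
  show "((\<lambda>y. - N * drift y * E y - Dx v y t) has_real_derivative
      - N * drift' x * E x + (N * drift x)\<^sup>2 * E x - Dx (Dx v) x t) (at x)" if "t > 0" for x t
    using that by (intro DERIV_diff E2 D) auto
  show "- Dt v x t = - N * drift' x * E x + (N * drift x)\<^sup>2 * E x - Dx (Dx v) x t
      + N * drift x * (- N * drift x * E x - Dx v x t) + N * drift' x * (E x - v x t)" if "t > 0" for x t
  proof -
    have "Dt v x t = Dx (Dx v) x t + N * Dx v x t * drift x + N * v x t * drift' x"
      using v that by (simp add: drift_solution_def deriv_Phi)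
    then show ?thesis by (simp add: algebra_simps power2_eq_square)
  qed
  show "0 \<le> E x - v x 0" for x
    using gibbs_deficit_initial[OF v, of x] by (simp add: E_def)
  show "uniform_limit {0..S} (\<lambda>x t. x\<^sup>2 * (E x - v x t)) (\<lambda>_. 0) at_infinity" if "S > 0" for S
  proof -
    have "uniform_limit {0..S} (\<lambda>x t. x\<^sup>2 * v x t) (\<lambda>_. 0) at_infinity"
      using v that by (simp add: drift_solution_def)
    moreover have "uniform_limit {0..S} (\<lambda>x t. x\<^sup>2 * E x) (\<lambda>_. 0) at_infinity"
      using square_times_gibbs_tendsto_0[OF N] by (auto simp: uniform_limit_iff tendsto_iff E_def)
    ultimately have "uniform_limit {0..S} (\<lambda>x t. x\<^sup>2 * E x - x\<^sup>2 * v x t) (\<lambda>t. 0 - 0) at_infinity"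
      by (intro uniform_limit_minus)
    then show ?thesis by (simp add: algebra_simps)
  qed
qed

lemma mass_one_minus_cos: "((\<lambda>x. 1 - cos (2 * pi * x)) has_integral 1) {0..1}"
proof -
  have "((\<lambda>x. 1 - cos (2 * pi * x)) has_integral
     (1 - sin (2 * pi * 1) / (2 * pi)) - (0 - sin (2 * pi * 0) / (2 * pi))) {0..1}"
    by (intro fundamental_theorem_of_calculus)
      (auto intro!: derivative_eq_intros simp flip: has_real_derivative_iff_has_vector_derivative)
  then show ?thesis by simp
qed

lemma interior_error_lower_bound:
  assumes u: "neumann_solution u" and N: "N > 0" and v: "drift_solution N v"
    and l: "0 < l" "l \<le> 1"
    and close: "\<And>x t. x \<in> {0..1} \<Longrightarrow> t \<in> {0..1} \<Longrightarrow> \<bar>u x t - v x t\<bar> \<le> e"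
  shows "5 / 4 \<le> (2 + 1 / l + 3 * N * l\<^sup>2) * e"
proof -
  define W where "W x t = 2 * exp (- N * \<Phi> x) - v x t" for x t
  interpret drift_equation N W "\<lambda>x t. - N * drift x * (2 * exp (- N * \<Phi> x)) - Dx v x t"
    "\<lambda>x t. - N * drift' x * (2 * exp (- N * \<Phi> x)) + (N * drift x)\<^sup>2 * (2 * exp (- N * \<Phi> x)) - Dx (Dx v) x t"
    "\<lambda>x t. - Dt v x t"
    unfolding W_def by (rule gibbs_deficit_drift_equation[OF N v])
  have initial: "W x 0 = (if x \<in> {0..1} then 1 - cos (2 * pi * x) else 0)" for x
    unfolding W_def by (rule gibbs_deficit_initial[OF v])
  have "((\<lambda>x. W x 0) has_integral 1) {0..1}"
    by (rule has_integral_eq[OF _ mass_one_minus_cos]) (simp add: initial)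
  moreover have "((\<lambda>x. W x 0) has_integral 1) UNIV"
    unfolding initial using mass_one_minus_cos by (simp only: has_integral_restrict_UNIV)
  ultimately have initial_mass: "integral {0..1} (\<lambda>x. W x 0) = 1"
    and total_mass: "(\<lambda>x. W x 0) integrable_on UNIV" "integral UNIV (\<lambda>x. W x 0) = 1"
    by (auto simp: integral_unique)
  show ?thesis
  proof (rule interior_defect_lower_bound[OF l initial_mass])
    show "W x 0 = 0" if "x \<notin> {0..1}" for x using that by (simp only: initial if_False)
    show "integral {- l..1 + l} (\<lambda>x. W x t) \<le> 1" if "t > 0" for t
    proof (rule mass_le)
      show "integral {- R..R} (\<lambda>x. W x 0) \<le> 1" if "R > 0" for R
        unfolding total_mass(2)[symmetric]
        by (intro integral_subset_le total_mass integrable_continuous_real continuous_slice)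
          (auto simp: nonneg)
    qed (use that in auto)
    show "1 - e \<le> integral {0..1} (\<lambda>x. W x t)" if t: "0 < t" "t < 1" for t
    proof -
      have int_u: "(\<lambda>x. u x t) integrable_on {0..1}"
        using u t by (intro neumann_solution_integrable) auto
      have "1 - e \<le> integral {0..1} (\<lambda>x. (2 - e) - u x t)"
        using neumann_solution_mass_le[OF u, of t] t
        by (subst Henstock_Kurzweil_Integration.integral_diff[OF _ int_u]) auto
      also have "\<dots> \<le> integral {0..1} (\<lambda>x. W x t)"
      proof (intro integral_le integrable_diff int_u integrable_const_ivl integrable_continuous_real continuous_slice)
        fix x :: real assume x: "x \<in> {0..1}"
        then have "\<Phi> x = 0" by (auto simp: \<Phi>_def)
        then show "2 - e - u x t \<le> W x t"
          using close[of x t] x t by (auto simp: W_def)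
      qed (use t in auto)
      finally show ?thesis .
    qed
  qed
qed

text \<open>
  The width \<open>l = k N powr (-1/3)\<close> has to be at most \<open>1\<close>, also for \<open>N = N0\<close> small; this fixes \<open>k\<close>. Then
  \<open>2\<close>, \<open>1/l\<close> and \<open>3 N l\<^sup>2\<close> are at most \<open>2/l\<close>, \<open>1/l\<close> and \<open>3/l\<close>, which gives \<open>e \<ge> l/6\<close>.
\<close>

theorem theorem5p2:
  fixes u :: "real \<Rightarrow> real \<Rightarrow> real"
  assumes "neumann_solution u"
  shows "\<exists>T>0. \<forall>N0>0. \<exists>C>0. \<forall>N\<ge>N0. \<forall>v. drift_solution N v \<longrightarrow>
           (SUP (x, t)\<in>{0..1} \<times> {0..T}. \<bar>u x t - v x t\<bar>) \<ge> C * N powr (- 1 / 3)"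
proof (rule exI[of _ 1], intro conjI allI impI)
  fix N0 :: real assume N0: "N0 > 0"
  define k where "k = min 1 (N0 powr (1 / 3))"
  have k: "0 < k" "k \<le> 1" "k \<le> N0 powr (1 / 3)" using N0 by (auto simp: k_def)
  show "\<exists>C>0. \<forall>N\<ge>N0. \<forall>v. drift_solution N v \<longrightarrow>
           (SUP (x, t)\<in>{0..1} \<times> {0..1}. \<bar>u x t - v x t\<bar>) \<ge> C * N powr (- 1 / 3)"
  proof (intro exI[of _ "k / 6"] conjI allI impI)
    fix N v assume N_ge: "N \<ge> N0" and v: "drift_solution N v"
    have N: "N > 0" using N0 N_ge by simp
    define e where "e = (SUP (x, t)\<in>{0..1} \<times> {0..1}. \<bar>u x t - v x t\<bar>)"
    have "compact ((\<lambda>(x, t). \<bar>u x t - v x t\<bar>) ` ({0..1} \<times> {0..1}))"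
    proof (intro compact_continuous_image compact_Times)
      have "continuous_on ({0..1} \<times> {0..1}) (\<lambda>(x, t). u x t)"
        using assms by (auto simp: neumann_solution_def intro: continuous_on_subset)
      moreover have "continuous_on ({0..1} \<times> {0..1}) (\<lambda>(x, t). v x t)"
        using v by (auto simp: drift_solution_def intro: continuous_on_subset)
      ultimately show "continuous_on ({0..1} \<times> {0..1}) (\<lambda>(x, t). \<bar>u x t - v x t\<bar>)"
        unfolding case_prod_unfold by (intro continuous_intros)
    qed auto
    then have "bdd_above ((\<lambda>(x, t). \<bar>u x t - v x t\<bar>) ` ({0..1} \<times> {0..1}))"
      by (intro bounded_imp_bdd_above compact_imp_bounded)
    from cSUP_upper[OF _ this]
    have close: "\<bar>u x t - v x t\<bar> \<le> e" if "x \<in> {0..1}" "t \<in> {0..1}" for x t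
      unfolding e_def using that by fastforce
    define s where "s = N powr (- 1 / 3)"
    have s: "s > 0" "N * s ^ 3 = 1"
    proof -
      have "s ^ 3 = N powr (- 1)"
        using N by (simp add: s_def powr_powr flip: powr_realpow)
      then show "N * s ^ 3 = 1" using N by (simp add: powr_minus)
    qed (use N in \<open>simp add: s_def\<close>)
    define l where "l = k * s"
    have l: "0 < l" "l \<le> 1"
    proof -
      have "k * s \<le> N powr (1 / 3) * s"
        using k N_ge N0 s powr_mono2[of "1 / 3" N0 N] by (intro mult_right_mono) auto
      also have "\<dots> = 1" using N by (simp add: s_def flip: powr_add)
      finally show "l \<le> 1" by (simp add: l_def)
    qed (use k s in \<open>simp add: l_def\<close>)
    have e: "e \<ge> 0" using close[of 0 0] by auto
    have "N * l ^ 3 \<le> 1"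
      using s k power_le_one[of k 3] by (simp add: l_def power_mult_distrib mult.left_commute[of N])
    then have "3 * N * l\<^sup>2 \<le> 3 / l"
      using l by (simp add: field_simps power2_eq_square power3_eq_cube)
    moreover have "2 \<le> 2 / l" using l by (simp add: field_simps)
    ultimately have "2 + 1 / l + 3 * N * l\<^sup>2 \<le> 6 / l" by (simp add: add_divide_distrib[symmetric])
    then have "(2 + 1 / l + 3 * N * l\<^sup>2) * e \<le> 6 / l * e"
      using e by (rule mult_right_mono)
    moreover have "5 / 4 \<le> (2 + 1 / l + 3 * N * l\<^sup>2) * e"
      by (rule interior_error_lower_bound[OF assms N v l close])
    ultimately have "1 \<le> 6 / l * e" by linarith
    then have "l / 6 \<le> e" using l by (simp add: field_simps)
    then show "k / 6 * N powr (- 1 / 3) \<le> (SUP (x, t)\<in>{0..1} \<times> {0..1}. \<bar>u x t - v x t\<bar>)"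
      by (simp add: e_def l_def s_def)
  qed (use k in auto)
qed auto

end
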